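(* Let $R$ and $S$ be unital $2$-torsion free rings, let $M$ be a unital $2$-torsion free $(R,S)$-bimodule which is faithful as a left $R$-module and faithful as a right $S$-module, and let $T=\mathrm{Tri}(R,M,S)$ be the associated triangular ring. Let $\varphi:T\to T$ be an additive map satisfying $$\varphi(XYX)=X\varphi(Y)X$$ for all $X,Y\in T$. Then $\varphi$ is a centralizer.
   Context: All rings are associative. The triangular ring $\mathrm{Tri}(R,M,S)$ is the ring of all matrices $\begin{pmatrix} r & m\\ 0 & s\end{pmatrix}$ with $r\in R$, $m\in M$, $s\in S$, under the usual matrix operations. A ring or module is $2$-torsion free if $2x=0$ implies $x=0$. An additive map $\varphi$ on a ring $A$ is a centralizer if $\varphi(xy)=x\varphi(y)=\varphi(x)y$ for all $x,y\in A$. *)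

theory Defs
  imports "HOL-Algebra.Module"
begin

(* As in the record type "module", the ring fields mult and one of a bimodule carry no meaning;
   smult is the left action, rsmult the right action. *)
record ('r, 's, 'm) bimodule = "('r, 'm) module" +
  rsmult :: "['m, 's] \<Rightarrow> 'm" (infixl "\<odot>\<^sub>r\<index>" 70)

(* Rings in the sense of the locale "ring" are associative and unital, and the zero ring is allowed. *)
locale bimodule =
  R?: ring R + S?: ring S + M?: abelian_group M
  for R :: "('r, 'x) ring_scheme" (structure)
    and S :: "('s, 'y) ring_scheme" (structure)
    and M :: "('r, 's, 'm, 'z) bimodule_scheme" (structure) +
  assumes smult_closed:
      "\<lbrakk>r \<in> carrier R; m \<in> carrier M\<rbrakk> \<Longrightarrow> r \<odot>\<^bsub>M\<^esub> m \<in> carrier M"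
    and smult_l_distr:
      "\<lbrakk>r \<in> carrier R; r' \<in> carrier R; m \<in> carrier M\<rbrakk>
        \<Longrightarrow> (r \<oplus>\<^bsub>R\<^esub> r') \<odot>\<^bsub>M\<^esub> m = r \<odot>\<^bsub>M\<^esub> m \<oplus>\<^bsub>M\<^esub> r' \<odot>\<^bsub>M\<^esub> m"
    and smult_r_distr:
      "\<lbrakk>r \<in> carrier R; m \<in> carrier M; n \<in> carrier M\<rbrakk>
        \<Longrightarrow> r \<odot>\<^bsub>M\<^esub> (m \<oplus>\<^bsub>M\<^esub> n) = r \<odot>\<^bsub>M\<^esub> m \<oplus>\<^bsub>M\<^esub> r \<odot>\<^bsub>M\<^esub> n"
    and smult_assoc:
      "\<lbrakk>r \<in> carrier R; r' \<in> carrier R; m \<in> carrier M\<rbrakk>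
        \<Longrightarrow> (r \<otimes>\<^bsub>R\<^esub> r') \<odot>\<^bsub>M\<^esub> m = r \<odot>\<^bsub>M\<^esub> (r' \<odot>\<^bsub>M\<^esub> m)"
    and smult_one:
      "m \<in> carrier M \<Longrightarrow> \<one>\<^bsub>R\<^esub> \<odot>\<^bsub>M\<^esub> m = m"
    and rsmult_closed:
      "\<lbrakk>m \<in> carrier M; s \<in> carrier S\<rbrakk> \<Longrightarrow> m \<odot>\<^sub>r\<^bsub>M\<^esub> s \<in> carrier M"
    and rsmult_l_distr:
      "\<lbrakk>m \<in> carrier M; n \<in> carrier M; s \<in> carrier S\<rbrakk>
        \<Longrightarrow> (m \<oplus>\<^bsub>M\<^esub> n) \<odot>\<^sub>r\<^bsub>M\<^esub> s = m \<odot>\<^sub>r\<^bsub>M\<^esub> s \<oplus>\<^bsub>M\<^esub> n \<odot>\<^sub>r\<^bsub>M\<^esub> s"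
    and rsmult_r_distr:
      "\<lbrakk>m \<in> carrier M; s \<in> carrier S; s' \<in> carrier S\<rbrakk>
        \<Longrightarrow> m \<odot>\<^sub>r\<^bsub>M\<^esub> (s \<oplus>\<^bsub>S\<^esub> s') = m \<odot>\<^sub>r\<^bsub>M\<^esub> s \<oplus>\<^bsub>M\<^esub> m \<odot>\<^sub>r\<^bsub>M\<^esub> s'"
    and rsmult_assoc:
      "\<lbrakk>m \<in> carrier M; s \<in> carrier S; s' \<in> carrier S\<rbrakk>
        \<Longrightarrow> m \<odot>\<^sub>r\<^bsub>M\<^esub> (s \<otimes>\<^bsub>S\<^esub> s') = (m \<odot>\<^sub>r\<^bsub>M\<^esub> s) \<odot>\<^sub>r\<^bsub>M\<^esub> s'"
    and rsmult_one:
      "m \<in> carrier M \<Longrightarrow> m \<odot>\<^sub>r\<^bsub>M\<^esub> \<one>\<^bsub>S\<^esub> = m"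
    and smult_rsmult_assoc:
      "\<lbrakk>r \<in> carrier R; m \<in> carrier M; s \<in> carrier S\<rbrakk>
        \<Longrightarrow> (r \<odot>\<^bsub>M\<^esub> m) \<odot>\<^sub>r\<^bsub>M\<^esub> s = r \<odot>\<^bsub>M\<^esub> (m \<odot>\<^sub>r\<^bsub>M\<^esub> s)"

definition faithful_left ::
    "('r, 'x) ring_scheme \<Rightarrow> ('r, 's, 'm, 'z) bimodule_scheme \<Rightarrow> bool" where
  "faithful_left R M \<longleftrightarrow>
    (\<forall>r \<in> carrier R. (\<forall>m \<in> carrier M. r \<odot>\<^bsub>M\<^esub> m = \<zero>\<^bsub>M\<^esub>) \<longrightarrow> r = \<zero>\<^bsub>R\<^esub>)"

definition faithful_right ::
    "('s, 'y) ring_scheme \<Rightarrow> ('r, 's, 'm, 'z) bimodule_scheme \<Rightarrow> bool" where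
  "faithful_right S M \<longleftrightarrow>
    (\<forall>s \<in> carrier S. (\<forall>m \<in> carrier M. m \<odot>\<^sub>r\<^bsub>M\<^esub> s = \<zero>\<^bsub>M\<^esub>) \<longrightarrow> s = \<zero>\<^bsub>S\<^esub>)"

definition two_torsion_free :: "('a, 'x) ring_scheme \<Rightarrow> bool" where
  "two_torsion_free A \<longleftrightarrow>
    (\<forall>x \<in> carrier A. [(2::nat)] \<cdot>\<^bsub>A\<^esub> x = \<zero>\<^bsub>A\<^esub> \<longrightarrow> x = \<zero>\<^bsub>A\<^esub>)"

(* The triple (r, m, s) stands for the matrix with rows (r m) and (0 s). *)
definition Tri ::
    "('r, 'x) ring_scheme \<Rightarrow> ('r, 's, 'm, 'z) bimodule_scheme \<Rightarrow> ('s, 'y) ring_scheme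
      \<Rightarrow> ('r \<times> 'm \<times> 's) ring" where
  "Tri R M S =
    \<lparr>carrier = carrier R \<times> carrier M \<times> carrier S,
     mult = (\<lambda>(r, m, s) (r', m', s').
       (r \<otimes>\<^bsub>R\<^esub> r', r \<odot>\<^bsub>M\<^esub> m' \<oplus>\<^bsub>M\<^esub> m \<odot>\<^sub>r\<^bsub>M\<^esub> s', s \<otimes>\<^bsub>S\<^esub> s')),
     one = (\<one>\<^bsub>R\<^esub>, \<zero>\<^bsub>M\<^esub>, \<one>\<^bsub>S\<^esub>),
     zero = (\<zero>\<^bsub>R\<^esub>, \<zero>\<^bsub>M\<^esub>, \<zero>\<^bsub>S\<^esub>),
     add = (\<lambda>(r, m, s) (r', m', s').
       (r \<oplus>\<^bsub>R\<^esub> r', m \<oplus>\<^bsub>M\<^esub> m', s \<oplus>\<^bsub>S\<^esub> s'))\<rparr>"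

definition additive_map :: "('a, 'x) ring_scheme \<Rightarrow> ('a \<Rightarrow> 'a) \<Rightarrow> bool" where
  "additive_map A \<phi> \<longleftrightarrow> \<phi> \<in> hom (add_monoid A) (add_monoid A)"

definition centralizer :: "('a, 'x) ring_scheme \<Rightarrow> ('a \<Rightarrow> 'a) \<Rightarrow> bool" where
  "centralizer A \<phi> \<longleftrightarrow> additive_map A \<phi> \<and>
    (\<forall>x \<in> carrier A. \<forall>y \<in> carrier A.
      \<phi> (x \<otimes>\<^bsub>A\<^esub> y) = x \<otimes>\<^bsub>A\<^esub> \<phi> y \<and> \<phi> (x \<otimes>\<^bsub>A\<^esub> y) = \<phi> x \<otimes>\<^bsub>A\<^esub> y)"

context bimodule
begin

lemma smult_zero: "r \<in> carrier R \<Longrightarrow> r \<odot>\<^bsub>M\<^esub> \<zero>\<^bsub>M\<^esub> = \<zero>\<^bsub>M\<^esub>"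
  by (metis M.add.l_cancel_one' M.zero_closed M.l_zero smult_closed smult_r_distr)

lemma zero_rsmult: "s \<in> carrier S \<Longrightarrow> \<zero>\<^bsub>M\<^esub> \<odot>\<^sub>r\<^bsub>M\<^esub> s = \<zero>\<^bsub>M\<^esub>"
  by (metis M.add.l_cancel_one' M.zero_closed M.l_zero rsmult_closed rsmult_l_distr)

lemma ring_Tri: "ring (Tri R M S)"
proof (rule ringI)
  show "abelian_group (Tri R M S)"
  proof (rule abelian_groupI)
    fix x assume "x \<in> carrier (Tri R M S)"
    then obtain r m s where x: "x = (r, m, s)"
      and "r \<in> carrier R" "m \<in> carrier M" "s \<in> carrier S"
      by (auto simp: Tri_def)
    then show "\<exists>y\<in>carrier (Tri R M S). y \<oplus>\<^bsub>Tri R M S\<^esub> x = \<zero>\<^bsub>Tri R M S\<^esub>"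
      by (intro bexI[where x = "(\<ominus>\<^bsub>R\<^esub> r, \<ominus>\<^bsub>M\<^esub> m, \<ominus>\<^bsub>S\<^esub> s)"])
         (auto simp: Tri_def R.l_neg M.l_neg S.l_neg)
  qed (auto simp: Tri_def R.a_ac M.a_ac S.a_ac)
  show "Group.monoid (Tri R M S)"
    by (rule monoidI)
       (auto simp: Tri_def R.m_assoc S.m_assoc M.a_assoc smult_closed rsmult_closed smult_r_distr
         rsmult_l_distr smult_assoc rsmult_assoc smult_rsmult_assoc smult_one rsmult_one
         smult_zero zero_rsmult)
qed (auto simp: Tri_def R.l_distr R.r_distr S.l_distr S.r_distr smult_closed rsmult_closed
       smult_l_distr smult_r_distr rsmult_l_distr rsmult_r_distr M.a_ac)

end

end

(* Put c = \<phi>(1).  Comparing \<phi>((x + 1)(x + 1)) with (x + 1)c(x + 1) gives 2\<phi>(x) = cx + xc, and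
   \<phi>(e) = ece for every idempotent e, so ce + ec = 2ece.  For the idempotents e = (1, n, 0) of
   Tri(R, M, S) this forces the corner entry of c to vanish and its diagonal entries a, b to satisfy
   an = nb for all n in M; faithfulness then makes a and b central.  So c is central, and
   2\<phi>(x) = 2cx. *)

theory Submission
  imports Defs
begin

lemma (in abelian_group) eq_of_minus_eq_zero:
  "\<lbrakk>x \<in> carrier G; y \<in> carrier G; x \<ominus> y = \<zero>\<rbrakk> \<Longrightarrow> x = y"
  by (metis add.inv_solve_right l_zero minus_eq zero_closed)

text \<open>Only additive structure is involved, so one form stated for abelian groups serves the
  rings \<open>R\<close> and \<open>S\<close>, the module \<open>M\<close> and the triangular
  ring.\<close>

lemma (in abelian_group) two_torsion_free_iff:
  "two_torsion_free G \<longleftrightarrow> (\<forall>x \<in> carrier G. x \<oplus> x = \<zero> \<longrightarrow> x = \<zero>)"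
  by (simp add: two_torsion_free_def numeral_2_eq_2)

section \<open>Additive maps with the sandwich identity on an arbitrary unital ring\<close>

context ring
begin

text \<open>Torsion-freeness is applied to \<open>x \<ominus> y\<close>. This is what later turns a
  formula for twice \<phi>(x) into one for \<phi>(x).\<close>

lemma two_torsion_free_cancel:
  assumes "two_torsion_free R" "x \<in> carrier R" "y \<in> carrier R" "x \<oplus> x = y \<oplus> y"
  shows "x = y"
proof -
  have "(x \<ominus> y) \<oplus> (x \<ominus> y) = (x \<oplus> x) \<ominus> (y \<oplus> y)"
    using assms(2,3) by (simp add: minus_eq minus_add a_ac)
  also have "\<dots> = \<zero>"
    using assms(3,4) by (simp add: minus_eq r_neg)
  finally have "x \<ominus> y = \<zero>"
    using assms(1-3) unfolding two_torsion_free_iff by blast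
  then show ?thesis
    using assms(2,3) by (simp add: eq_of_minus_eq_zero)
qed

context
  fixes \<phi>
  assumes additive: "additive_map R \<phi>"
    and sandwich: "\<And>x y. \<lbrakk>x \<in> carrier R; y \<in> carrier R\<rbrakk> \<Longrightarrow> \<phi> (x \<otimes> y \<otimes> x) = x \<otimes> \<phi> y \<otimes> x"
begin

lemma sandwich_closed: "x \<in> carrier R \<Longrightarrow> \<phi> x \<in> carrier R"
  using additive by (auto simp: additive_map_def hom_def)

lemma sandwich_add:
  "\<lbrakk>x \<in> carrier R; y \<in> carrier R\<rbrakk> \<Longrightarrow> \<phi> (x \<oplus> y) = \<phi> x \<oplus> \<phi> y"
  using additive by (auto simp: additive_map_def hom_def)

lemma sandwich_square: "x \<in> carrier R \<Longrightarrow> \<phi> (x \<otimes> x) = x \<otimes> \<phi> \<one> \<otimes> x"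
  using sandwich[of x \<one>] by simp

lemma sandwich_double:
  assumes x: "x \<in> carrier R"
  shows "\<phi> x \<oplus> \<phi> x = \<phi> \<one> \<otimes> x \<oplus> x \<otimes> \<phi> \<one>"
proof -
  note closed = x sandwich_closed[OF x] sandwich_closed[OF one_closed]
  let ?q = "x \<otimes> \<phi> \<one> \<otimes> x"
  have "(x \<oplus> \<one>) \<otimes> (x \<oplus> \<one>) = x \<otimes> x \<oplus> (x \<oplus> (x \<oplus> \<one>))"
    using x by (simp add: l_distr r_distr a_assoc)
  \<comment> \<open>The same element is evaluated twice, here by expanding the square and using
    additivity, then by the sandwich identity for \<open>x \<oplus> \<one>\<close>. Both results are
    bracketed with \<open>?q\<close> in front and \<open>\<phi> \<one>\<close> at the end, so that
    cancelling these two leaves the claim.\<close>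
  then have "\<phi> ((x \<oplus> \<one>) \<otimes> (x \<oplus> \<one>)) = ?q \<oplus> ((\<phi> x \<oplus> \<phi> x) \<oplus> \<phi> \<one>)"
    using closed by (simp add: sandwich_add sandwich_square a_assoc)
  moreover have "\<phi> ((x \<oplus> \<one>) \<otimes> (x \<oplus> \<one>)) = ?q \<oplus> ((\<phi> \<one> \<otimes> x \<oplus> x \<otimes> \<phi> \<one>) \<oplus> \<phi> \<one>)"
    using closed by (subst sandwich_square) (simp_all add: l_distr r_distr a_ac)
  ultimately show ?thesis
    using closed by simp
qed

text \<open>Both sides are \<phi>(e) + \<phi>(e): the left by \<open>sandwich_double\<close>, the
  right because e = ee is a square. Keeping the identity doubled avoids any division by 2.\<close>

lemma sandwich_idempotent:
  assumes "e \<in> carrier R" "e \<otimes> e = e"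
  shows "\<phi> \<one> \<otimes> e \<oplus> e \<otimes> \<phi> \<one> = e \<otimes> \<phi> \<one> \<otimes> e \<oplus> e \<otimes> \<phi> \<one> \<otimes> e"
  using sandwich_double[OF assms(1)] sandwich_square[OF assms(1)] assms(2) by simp

text \<open>Once \<phi>(1) is central, halving \<open>sandwich_double\<close> shows that \<phi> is
  multiplication by \<phi>(1). Both centralizer identities then come from associativity and from
  moving \<phi>(1) past x.\<close>

lemma sandwich_centralizer:
  assumes tf: "two_torsion_free R"
    and central: "\<And>x. x \<in> carrier R \<Longrightarrow> \<phi> \<one> \<otimes> x = x \<otimes> \<phi> \<one>"
  shows "centralizer R \<phi>"
proof -
  have eq: "\<phi> x = \<phi> \<one> \<otimes> x" if "x \<in> carrier R" for x
  proof (rule two_torsion_free_cancel[OF tf])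
    show "\<phi> x \<oplus> \<phi> x = \<phi> \<one> \<otimes> x \<oplus> \<phi> \<one> \<otimes> x"
      using sandwich_double[OF that] central[OF that] by simp
  qed (use that sandwich_closed in simp_all)
  have "\<phi> (x \<otimes> y) = x \<otimes> \<phi> y \<and> \<phi> (x \<otimes> y) = \<phi> x \<otimes> y"
    if x: "x \<in> carrier R" and y: "y \<in> carrier R" for x y
  proof -
    note c = sandwich_closed[OF one_closed]
    have "\<phi> (x \<otimes> y) = (\<phi> \<one> \<otimes> x) \<otimes> y"
      using x y c by (simp add: eq[of "x \<otimes> y"] m_assoc)
    moreover have "(\<phi> \<one> \<otimes> x) \<otimes> y = x \<otimes> (\<phi> \<one> \<otimes> y)"
      using x y c by (simp add: central[OF x] m_assoc)
    ultimately show ?thesis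
      using x y by (simp only: eq[of x, symmetric] eq[of y, symmetric])
  qed
  then show ?thesis
    using additive unfolding centralizer_def by blast
qed

end

end

section \<open>Centrality in a triangular ring over a faithful bimodule\<close>

context bimodule
begin

lemma two_torsion_free_Tri:
  assumes "two_torsion_free R" "two_torsion_free S" "two_torsion_free M"
  shows "two_torsion_free (Tri R M S)"
proof -
  interpret T: ring "Tri R M S" by (rule ring_Tri)
  show ?thesis
    unfolding T.two_torsion_free_iff
  proof (intro ballI impI)
    fix x assume "x \<in> carrier (Tri R M S)"
      and "x \<oplus>\<^bsub>Tri R M S\<^esub> x = \<zero>\<^bsub>Tri R M S\<^esub>"
    moreover obtain r m s where "x = (r, m, s)"
      by (cases x)
    ultimately have "x = (r, m, s)" "r \<in> carrier R" "m \<in> carrier M" "s \<in> carrier S"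
      "r \<oplus>\<^bsub>R\<^esub> r = \<zero>\<^bsub>R\<^esub>" "m \<oplus>\<^bsub>M\<^esub> m = \<zero>\<^bsub>M\<^esub>" "s \<oplus>\<^bsub>S\<^esub> s = \<zero>\<^bsub>S\<^esub>"
      by (simp_all add: Tri_def)
    moreover from this have "r = \<zero>\<^bsub>R\<^esub>" "m = \<zero>\<^bsub>M\<^esub>" "s = \<zero>\<^bsub>S\<^esub>"
      using assms R.two_torsion_free_iff S.two_torsion_free_iff M.two_torsion_free_iff by blast+
    ultimately show "x = \<zero>\<^bsub>Tri R M S\<^esub>"
      by (simp add: Tri_def)
  qed
qed

text \<open>On M the left action of a can be traded for the right action of b, which commutes with
  r: a(rm) = (rm)b = r(mb) = r(am). Hence ar - ra annihilates M, and faithfulness applies.\<close>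

lemma central_of_balanced_left:
  assumes faithful: "faithful_left R M"
    and a: "a \<in> carrier R" and b: "b \<in> carrier S" and r: "r \<in> carrier R"
    and balanced: "\<And>m. m \<in> carrier M \<Longrightarrow> a \<odot>\<^bsub>M\<^esub> m = m \<odot>\<^sub>r\<^bsub>M\<^esub> b"
  shows "a \<otimes>\<^bsub>R\<^esub> r = r \<otimes>\<^bsub>R\<^esub> a"
proof -
  have "(a \<otimes>\<^bsub>R\<^esub> r \<ominus>\<^bsub>R\<^esub> r \<otimes>\<^bsub>R\<^esub> a) \<odot>\<^bsub>M\<^esub> m = \<zero>\<^bsub>M\<^esub>" if m: "m \<in> carrier M" for m
  proof -
    have eq: "(a \<otimes>\<^bsub>R\<^esub> r) \<odot>\<^bsub>M\<^esub> m = (r \<otimes>\<^bsub>R\<^esub> a) \<odot>\<^bsub>M\<^esub> m"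
      using a b r m by (simp add: smult_assoc balanced smult_closed smult_rsmult_assoc)
    \<comment> \<open>The bimodule axioms distribute over sums only, so the action of the difference
      is found by adding (ra)m back and cancelling it.\<close>
    have "(a \<otimes>\<^bsub>R\<^esub> r \<ominus>\<^bsub>R\<^esub> r \<otimes>\<^bsub>R\<^esub> a) \<odot>\<^bsub>M\<^esub> m \<oplus>\<^bsub>M\<^esub> (r \<otimes>\<^bsub>R\<^esub> a) \<odot>\<^bsub>M\<^esub> m
        = (a \<otimes>\<^bsub>R\<^esub> r \<ominus>\<^bsub>R\<^esub> r \<otimes>\<^bsub>R\<^esub> a \<oplus>\<^bsub>R\<^esub> r \<otimes>\<^bsub>R\<^esub> a) \<odot>\<^bsub>M\<^esub> m"
      using a r m by (simp add: smult_l_distr)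
    also have "\<dots> = (r \<otimes>\<^bsub>R\<^esub> a) \<odot>\<^bsub>M\<^esub> m"
      using a r eq by (simp add: R.minus_eq R.a_assoc R.l_neg)
    finally show ?thesis
      using a r m by (simp add: smult_closed)
  qed
  then have "a \<otimes>\<^bsub>R\<^esub> r \<ominus>\<^bsub>R\<^esub> r \<otimes>\<^bsub>R\<^esub> a = \<zero>\<^bsub>R\<^esub>"
    using faithful a r by (simp add: faithful_left_def)
  then show ?thesis
    using a r by (simp add: R.eq_of_minus_eq_zero)
qed

text \<open>Mirror image of the left case: (mb)s = (am)s = a(ms) = (ms)b, so bs - sb annihilates M
  from the right.\<close>

lemma central_of_balanced_right:
  assumes faithful: "faithful_right S M"
    and a: "a \<in> carrier R" and b: "b \<in> carrier S" and s: "s \<in> carrier S"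
    and balanced: "\<And>m. m \<in> carrier M \<Longrightarrow> a \<odot>\<^bsub>M\<^esub> m = m \<odot>\<^sub>r\<^bsub>M\<^esub> b"
  shows "b \<otimes>\<^bsub>S\<^esub> s = s \<otimes>\<^bsub>S\<^esub> b"
proof -
  have "m \<odot>\<^sub>r\<^bsub>M\<^esub> (b \<otimes>\<^bsub>S\<^esub> s \<ominus>\<^bsub>S\<^esub> s \<otimes>\<^bsub>S\<^esub> b) = \<zero>\<^bsub>M\<^esub>" if m: "m \<in> carrier M" for m
  proof -
    have eq: "m \<odot>\<^sub>r\<^bsub>M\<^esub> (b \<otimes>\<^bsub>S\<^esub> s) = m \<odot>\<^sub>r\<^bsub>M\<^esub> (s \<otimes>\<^bsub>S\<^esub> b)"
      using a b s m
      by (simp add: rsmult_assoc balanced[symmetric] rsmult_closed smult_rsmult_assoc)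
    have "m \<odot>\<^sub>r\<^bsub>M\<^esub> (b \<otimes>\<^bsub>S\<^esub> s \<ominus>\<^bsub>S\<^esub> s \<otimes>\<^bsub>S\<^esub> b) \<oplus>\<^bsub>M\<^esub> m \<odot>\<^sub>r\<^bsub>M\<^esub> (s \<otimes>\<^bsub>S\<^esub> b)
        = m \<odot>\<^sub>r\<^bsub>M\<^esub> (b \<otimes>\<^bsub>S\<^esub> s \<ominus>\<^bsub>S\<^esub> s \<otimes>\<^bsub>S\<^esub> b \<oplus>\<^bsub>S\<^esub> s \<otimes>\<^bsub>S\<^esub> b)"
      using b s m by (simp add: rsmult_r_distr)
    also have "\<dots> = m \<odot>\<^sub>r\<^bsub>M\<^esub> (s \<otimes>\<^bsub>S\<^esub> b)"
      using b s eq by (simp add: S.minus_eq S.a_assoc S.l_neg)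
    finally show ?thesis
      using b s m by (simp add: rsmult_closed)
  qed
  then have "b \<otimes>\<^bsub>S\<^esub> s \<ominus>\<^bsub>S\<^esub> s \<otimes>\<^bsub>S\<^esub> b = \<zero>\<^bsub>S\<^esub>"
    using faithful b s by (simp add: faithful_right_def)
  then show ?thesis
    using b s by (simp add: S.eq_of_minus_eq_zero)
qed

lemma zero_smult: "m \<in> carrier M \<Longrightarrow> \<zero>\<^bsub>R\<^esub> \<odot>\<^bsub>M\<^esub> m = \<zero>\<^bsub>M\<^esub>"
  by (metis M.add.l_cancel_one' R.zero_closed R.l_zero smult_closed smult_l_distr)

lemma rsmult_zero: "m \<in> carrier M \<Longrightarrow> m \<odot>\<^sub>r\<^bsub>M\<^esub> \<zero>\<^bsub>S\<^esub> = \<zero>\<^bsub>M\<^esub>"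
  by (metis M.add.l_cancel_one' S.zero_closed S.l_zero rsmult_closed rsmult_r_distr)

text \<open>The element \<open>c\<close> stands for \<phi>(1), and \<open>idem\<close> has the shape
  of \<open>sandwich_idempotent\<close>. No map occurs here, so the argument is a pure matrix
  computation.\<close>

lemma Tri_central:
  assumes faithful: "faithful_left R M" "faithful_right S M"
    and c: "c \<in> carrier (Tri R M S)"
    and idem: "\<And>e. \<lbrakk>e \<in> carrier (Tri R M S); e \<otimes>\<^bsub>Tri R M S\<^esub> e = e\<rbrakk> \<Longrightarrow>
      c \<otimes>\<^bsub>Tri R M S\<^esub> e \<oplus>\<^bsub>Tri R M S\<^esub> e \<otimes>\<^bsub>Tri R M S\<^esub> c
      = e \<otimes>\<^bsub>Tri R M S\<^esub> c \<otimes>\<^bsub>Tri R M S\<^esub> e \<oplus>\<^bsub>Tri R M S\<^esub> e \<otimes>\<^bsub>Tri R M S\<^esub> c \<otimes>\<^bsub>Tri R M S\<^esub> e"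
    and x: "x \<in> carrier (Tri R M S)"
  shows "c \<otimes>\<^bsub>Tri R M S\<^esub> x = x \<otimes>\<^bsub>Tri R M S\<^esub> c"
proof -
  obtain a k b where c_eq: "c = (a, k, b)"
    and a: "a \<in> carrier R" and k: "k \<in> carrier M" and b: "b \<in> carrier S"
    using c by (auto simp: Tri_def)
  have corner: "k \<oplus>\<^bsub>M\<^esub> n \<odot>\<^sub>r\<^bsub>M\<^esub> b = a \<odot>\<^bsub>M\<^esub> n" if n: "n \<in> carrier M" for n
  proof -
    have "(\<one>\<^bsub>R\<^esub>, n, \<zero>\<^bsub>S\<^esub>) \<in> carrier (Tri R M S)"
      "(\<one>\<^bsub>R\<^esub>, n, \<zero>\<^bsub>S\<^esub>) \<otimes>\<^bsub>Tri R M S\<^esub> (\<one>\<^bsub>R\<^esub>, n, \<zero>\<^bsub>S\<^esub>) = (\<one>\<^bsub>R\<^esub>, n, \<zero>\<^bsub>S\<^esub>)"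
      using n by (auto simp: Tri_def smult_one rsmult_zero)
    \<comment> \<open>For e = (1, n, 0) the corner entries of ce, ec and ece are an, k + nb and an.
      Comparing corners and cancelling one an gives the claim.\<close>
    from idem[OF this]
    have "a \<odot>\<^bsub>M\<^esub> n \<oplus>\<^bsub>M\<^esub> (k \<oplus>\<^bsub>M\<^esub> n \<odot>\<^sub>r\<^bsub>M\<^esub> b) = a \<odot>\<^bsub>M\<^esub> n \<oplus>\<^bsub>M\<^esub> a \<odot>\<^bsub>M\<^esub> n"
      using a b k n
      by (simp add: c_eq Tri_def smult_one rsmult_zero smult_closed rsmult_closed)
    then show ?thesis
      using a b k n by (simp add: smult_closed rsmult_closed)
  qed
  \<comment> \<open>The choice n = 0, that is, the diagonal idempotent (1, 0, 0), isolates
    k.\<close>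
  have k0: "k = \<zero>\<^bsub>M\<^esub>"
    using corner[OF M.zero_closed] a b k by (simp add: smult_zero zero_rsmult)
  have balanced: "a \<odot>\<^bsub>M\<^esub> n = n \<odot>\<^sub>r\<^bsub>M\<^esub> b" if "n \<in> carrier M" for n
    using corner[OF that] that b by (simp add: k0 rsmult_closed)
  obtain r m s where x_eq: "x = (r, m, s)"
    and r: "r \<in> carrier R" and m: "m \<in> carrier M" and s: "s \<in> carrier S"
    using x by (auto simp: Tri_def)
  \<comment> \<open>Now c is diagonal, so cx = (ar, am, bs) and xc = (ra, mb, sb). The diagonal
    entries agree by centrality of a and b, the corners by \<open>balanced\<close>.\<close>
  show ?thesis
    using central_of_balanced_left[OF faithful(1) a b r balanced]
      central_of_balanced_right[OF faithful(2) a b s balanced] a b r m s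
    by (simp add: c_eq x_eq k0 Tri_def balanced smult_zero zero_rsmult rsmult_closed)
qed

end

theorem corollary3p3:
  fixes R :: "('r, 'x) ring_scheme"
    and S :: "('s, 'y) ring_scheme"
    and M :: "('r, 's, 'm, 'z) bimodule_scheme"
    and \<phi> :: "'r \<times> 'm \<times> 's \<Rightarrow> 'r \<times> 'm \<times> 's"
  defines "T \<equiv> Tri R M S"
  assumes "ring R" and "two_torsion_free R"
    and "ring S" and "two_torsion_free S"
    and "bimodule R S M" and "two_torsion_free M"
    and "faithful_left R M" and "faithful_right S M"
    and "additive_map T \<phi>"
    and "\<And>X Y. \<lbrakk>X \<in> carrier T; Y \<in> carrier T\<rbrakk>
      \<Longrightarrow> \<phi> (X \<otimes>\<^bsub>T\<^esub> Y \<otimes>\<^bsub>T\<^esub> X) = X \<otimes>\<^bsub>T\<^esub> \<phi> Y \<otimes>\<^bsub>T\<^esub> X"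
  shows "centralizer T \<phi>"
proof -
  interpret bimodule R S M by fact
  interpret T: ring T unfolding T_def by (rule ring_Tri)
  note additive = \<open>additive_map T \<phi>\<close> and sandwich = assms(11)
  have tf: "two_torsion_free T"
    unfolding T_def using assms by (intro two_torsion_free_Tri)
  have c: "\<phi> \<one>\<^bsub>T\<^esub> \<in> carrier T"
    by (rule T.sandwich_closed[OF additive]) (simp_all add: sandwich)
  \<comment> \<open>\<open>c\<close> and \<open>idem\<close> are all that \<open>Tri_central\<close>
    has to know about \<phi>.\<close>
  have idem: "\<phi> \<one>\<^bsub>T\<^esub> \<otimes>\<^bsub>T\<^esub> e \<oplus>\<^bsub>T\<^esub> e \<otimes>\<^bsub>T\<^esub> \<phi> \<one>\<^bsub>T\<^esub>
      = e \<otimes>\<^bsub>T\<^esub> \<phi> \<one>\<^bsub>T\<^esub> \<otimes>\<^bsub>T\<^esub> e \<oplus>\<^bsub>T\<^esub> e \<otimes>\<^bsub>T\<^esub> \<phi> \<one>\<^bsub>T\<^esub> \<otimes>\<^bsub>T\<^esub> e"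
    if "e \<in> carrier T" "e \<otimes>\<^bsub>T\<^esub> e = e" for e
    using that by (intro T.sandwich_idempotent[OF additive]) (simp_all add: sandwich)
  show ?thesis
  proof (rule T.sandwich_centralizer[OF additive _ tf])
    fix x assume "x \<in> carrier T"
    then show "\<phi> \<one>\<^bsub>T\<^esub> \<otimes>\<^bsub>T\<^esub> x = x \<otimes>\<^bsub>T\<^esub> \<phi> \<one>\<^bsub>T\<^esub>"
      unfolding T_def
      by (intro Tri_central[OF \<open>faithful_left R M\<close> \<open>faithful_right S M\<close>])
        (use c idem in \<open>simp_all add: T_def\<close>)
  qed (simp add: sandwich)
qed

end
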